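(* Let $\mathcal{G}$ be a bipartite graph with weights $W\in\overline{\mathbb{R}}^{n\times m}$ and let $\Pi\in\mathbf{BAP}(W)$. If the Uniqueness Assumption for the Assignment Sensitivity Algorithm holds, then the array of intervals $\Lambda^*$ returned by the Assignment Sensitivity Algorithm on input $(\mathcal{G},W,\Pi)$ satisfies $$\Lambda^*=\operatorname{lexmax}\left(\mathcal{L}_0\cap\mathcal{L}_A\right).$$ Equivalently, $\Lambda^*$ is the lexicographically largest array of intervals $([-\underline{\lambda}^*_e,\overline{\lambda}^*_e])_{e\in\mathcal{E}}$ such that $\underline{\lambda}^*_e,\overline{\lambda}^*_e\ge 0$ for all $e\in\mathcal{E}$ and every perturbation $P\in\Lambda^*$ satisfies $\Pi\in\mathbf{BAP}(W+P)$.
   Context: Graph and assignments. $\mathcal{G}=(\mathcal{V}_1\cup\mathcal{V}_2,\mathcal{E})$ is a bipartite graph with disjoint vertex sets, $\mathcal{E}\subseteq\mathcal{V}_1\times\mathcal{V}_2$, $n=|\mathcal{V}_1|\ge m=|\mathcal{V}_2|\ge 1$. $\overline{\mathbb{R}}=\mathbb{R}\cup\{-\infty,+\infty\}$. The weight matrix $W\in\overline{\mathbb{R}}^{n\times m}$ has entry $w_e$ for each edge $e\in\mathcal{E}$, and entry $+\infty$ for each pair not in $\mathcal{E}$. An assignment is a set $\Pi\subseteq\mathcal{E}$ such that every vertex of $\mathcal{V}_2$ lies in exactly one edge of $\Pi$ and every vertex of $\mathcal{V}_1$ lies in at most one edge of $\Pi$. $\mathcal{P}^{n\times m}$ is the set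 of all assignments. Bottleneck notions. For any weights $W$, $\mathbf{BAP}(W)$ is the set of bottleneck assignments, i.e. assignments $\Pi$ minimising $\max_{e\in\Pi}w_e$ over $\mathcal{P}^{n\times m}$. $\mathbf{E}(W)$ is the set of bottleneck edges, i.e. the maximum weight edges in all bottleneck assignments: edges $e$ for which there is $\Pi\in\mathbf{BAP}(W)$ with $e\in\Pi$ and $w_e=\max_{e'\in\Pi}w_{e'}$. Arrays of intervals. An array of intervals $\Lambda\subseteq\overline{\mathbb{R}}^{n\times m}$ is an $n\times m$ array of intervals over the extended reals, written $\Lambda=([-\underline{\lambda}_e,\overline{\lambda}_e])_{e\in\mathcal{E}}$, where $[-\underline{\lambda}_e,\overline{\lambda}_e]$ is the interval of edge $e$. A perturbation $P\in\overline{\mathbb{R}}^{n\times m}$, with element $P[e]$ corresponding to edge $e$, satisfies $P\in\Lambda$ if $P[e]\in[-\underline{\lambda}_e,\overline{\lambda}_e]$ for all $e\in\mathcal{E}$. $\mathcal{L}_0$ is the set of arrays containing the zero perturbation (equivalently, all $\underline{\lambda}_e,\overline{\lambda}_e\ge0$). $\mathcal{L}_A$ is the set of arrays $\Lambda$ such that $\Pi\in\mathbf{BAP}(W+P)$ for all $P\in\Lambda$, where $\Pi$ is the given assignment. Lexicographic order. $\rho_k(\Lambda)$ is the $k$-th minimum magnitude upper or lower bound of any of the intervals in $\Lambda$. $\Lambda_a\succ\Lambda_b$ if there is $i\in\{1,\dots,nm\}$ with $\rho_i(\Lambda_a)>\rho_i(\Lambda_b)$ and $\rho_k(\Lambda_a)=\rho_k(\Lambda_b)$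 for all $k<i$; $\succeq$ denotes the corresponding non-strict lexicographic ordering. $\operatorname{lexmax}(\mathcal{I})$ denotes a lexicographic maximal element of the set $\mathcal{I}$ of arrays, i.e. $\Lambda^*\in\mathcal{I}$ with $\Lambda^*\succeq\Lambda$ for all $\Lambda\in\mathcal{I}$. The function boundValue (the value $\infty$ for a $\lambda$ indicates an undetermined bound). $\mathrm{boundValue}(w_e,w_{e'},\overline{\lambda}_e,\underline{\lambda}_{e'})$ equals: - $\frac{w_{e'}-w_e}{2}$ if $\overline{\lambda}_e=\infty$ and $\underline{\lambda}_{e'}=\infty$; - $w_{e'}-\underline{\lambda}_{e'}-w_e$ if $\overline{\lambda}_e=\infty$ and $\underline{\lambda}_{e'}\neq\infty$; - $w_{e'}-w_e-\overline{\lambda}_e$ if $\overline{\lambda}_e\ne\infty$ and $\underline{\lambda}_{e'}=\infty$; - if both are $\ne\infty$: $\infty$ when $w_e+\overline{\lambda}_e\le w_{e'}-\underline{\lambda}_{e'}$, and $-\infty$ otherwise. Assignment Sensitivity Algorithm (input $\mathcal{G},W,\Pi$). Initialise $\underline{\lambda}_e=\overline{\lambda}_e=\infty$ for all $e\in\mathcal{E}$. Repeat: 1. For each $e\in\Pi$, form weights $B_e$ on $\mathcal{E}$ by $B_e[e']=\mathrm{boundValue}(w_e,w_{e'},\overline{\lambda}_e,\underline{\lambda}_{e'})$ for $e'\in\mathcal{E}\setminus\{e\}$ and $B_e[e]=\infty$; let $b_e$ be a bottleneck edge for the weights $B_e$, i.e. $b_e\in\mathbf{E}(B_e)$. 2.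 Let $\widehat{e}\in\arg\min_{e\in\Pi}B_e[b_e]$. 3. If $B_{\widehat{e}}[b_{\widehat{e}}]=\infty$, stop and return $\Lambda=([-\underline{\lambda}_e,\overline{\lambda}_e])_{e\in\mathcal{E}}$. 4. If $\overline{\lambda}_{\widehat{e}}=\infty$, set $\overline{\lambda}_{\widehat{e}}\leftarrow B_{\widehat{e}}[b_{\widehat{e}}]$. If $\underline{\lambda}_{b_{\widehat{e}}}=\infty$, set $\underline{\lambda}_{b_{\widehat{e}}}\leftarrow B_{\widehat{e}}[b_{\widehat{e}}]$. Uniqueness Assumption. The bottleneck edges for all weights $B_e$ constructed in the algorithm are unique.
   Formalization: Edges of Π are assumed not to have weight −∞ (else w_e+P[e] meets the undefined −∞+∞ for P in the returned array); uniqueness of bottleneck edges is required only for weights B_e whose bottleneck value is not ∞, as the literal assumption fails once a bound is set. *)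

theory Defs
  imports "HOL-Library.Extended_Real" "HOL-Library.Multiset"
begin

record 'v bigraph =
  lpart :: "'v set"
  rpart :: "'v set"
  edges :: "('v \<times> 'v) set"

definition bipartite_graph :: "'v bigraph \<Rightarrow> bool" where
  "bipartite_graph G \<longleftrightarrow>
     finite (lpart G) \<and> finite (rpart G) \<and> lpart G \<inter> rpart G = {} \<and>
     edges G \<subseteq> lpart G \<times> rpart G \<and>
     card (lpart G) \<ge> card (rpart G) \<and> card (rpart G) \<ge> 1"

definition weight_matrix :: "'v bigraph \<Rightarrow> ('v \<times> 'v \<Rightarrow> ereal) \<Rightarrow> bool" where
  "weight_matrix G W \<longleftrightarrow> (\<forall>p \<in> lpart G \<times> rpart G - edges G. W p = \<infinity>)"


subsection \<open>Bottleneck assignments\<close>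

definition assignments :: "'v bigraph \<Rightarrow> ('v \<times> 'v) set set" where
  "assignments G = {A. A \<subseteq> edges G \<and>
     (\<forall>v \<in> rpart G. \<exists>!e. e \<in> A \<and> snd e = v) \<and>
     (\<forall>u \<in> lpart G. \<forall>e \<in> A. \<forall>e' \<in> A. fst e = u \<and> fst e' = u \<longrightarrow> e = e')}"

definition bottleneck :: "('v \<times> 'v \<Rightarrow> ereal) \<Rightarrow> ('v \<times> 'v) set \<Rightarrow> ereal" where
  "bottleneck w A = Max (w ` A)"

definition BAP :: "'v bigraph \<Rightarrow> ('v \<times> 'v \<Rightarrow> ereal) \<Rightarrow> ('v \<times> 'v) set set" where
  "BAP G w = {A. is_arg_min (bottleneck w) (\<lambda>A. A \<in> assignments G) A}"

definition bottleneck_edges :: "'v bigraph \<Rightarrow> ('v \<times> 'v \<Rightarrow> ereal) \<Rightarrow> ('v \<times> 'v) set" where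
  "bottleneck_edges G w = {e. \<exists>A \<in> BAP G w. e \<in> A \<and> w e = bottleneck w A}"


subsection \<open>Arrays of intervals\<close>

text \<open>The interval of edge \<open>e\<close> is \<open>[- lower \<Lambda> e, upper \<Lambda> e]\<close>: the field
  \<open>lower\<close> holds the lower bound with its sign flipped.  Only the values on the
  edges of the graph are ever used.\<close>

record 'v interval_array =
  lower :: "'v \<times> 'v \<Rightarrow> ereal"
  upper :: "'v \<times> 'v \<Rightarrow> ereal"

definition in_array :: "'v bigraph \<Rightarrow> ('v \<times> 'v \<Rightarrow> ereal) \<Rightarrow> 'v interval_array \<Rightarrow> bool" where
  "in_array G P \<Lambda> \<longleftrightarrow> (\<forall>e \<in> edges G. P e \<in> {- lower \<Lambda> e .. upper \<Lambda> e})"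

definition L0 :: "'v bigraph \<Rightarrow> 'v interval_array set" where
  "L0 G = {\<Lambda>. in_array G (\<lambda>_. 0) \<Lambda>}"

definition LA ::
  "'v bigraph \<Rightarrow> ('v \<times> 'v \<Rightarrow> ereal) \<Rightarrow> ('v \<times> 'v) set \<Rightarrow> 'v interval_array set" where
  "LA G W \<Pi> = {\<Lambda>. \<forall>P. in_array G P \<Lambda> \<longrightarrow> \<Pi> \<in> BAP G (\<lambda>e. W e + P e)}"


subsection \<open>Lexicographic order\<close>

definition bound_magnitudes :: "'v bigraph \<Rightarrow> 'v interval_array \<Rightarrow> ereal list" where
  "bound_magnitudes G \<Lambda> = sorted_list_of_multiset
     (image_mset (\<lambda>e. \<bar>- lower \<Lambda> e\<bar>) (mset_set (edges G)) +
      image_mset (\<lambda>e. \<bar>upper \<Lambda> e\<bar>) (mset_set (edges G)))"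

text \<open>Counted from \<open>k = 1\<close>, with multiplicity.  If \<open>k\<close> exceeds the number of bounds
  the value is \<open>\<infinity>\<close>, as if each pair outside the edge set carried \<open>[-\<infinity>, \<infinity>]\<close>.\<close>

definition rho :: "'v bigraph \<Rightarrow> nat \<Rightarrow> 'v interval_array \<Rightarrow> ereal" where
  "rho G k \<Lambda> = (let xs = bound_magnitudes G \<Lambda> in
     if k \<le> length xs then xs ! (k - 1) else \<infinity>)"

definition lex_indices :: "'v bigraph \<Rightarrow> nat set" where
  "lex_indices G = {1 .. card (lpart G) * card (rpart G)}"

definition lex_greater :: "'v bigraph \<Rightarrow> 'v interval_array \<Rightarrow> 'v interval_array \<Rightarrow> bool" where
  "lex_greater G \<Lambda>a \<Lambda>b \<longleftrightarrow>
     (\<exists>i \<in> lex_indices G. rho G i \<Lambda>a > rho G i \<Lambda>b \<and>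
        (\<forall>k \<in> lex_indices G. k < i \<longrightarrow> rho G k \<Lambda>a = rho G k \<Lambda>b))"

definition lex_geq :: "'v bigraph \<Rightarrow> 'v interval_array \<Rightarrow> 'v interval_array \<Rightarrow> bool" where
  "lex_geq G \<Lambda>a \<Lambda>b \<longleftrightarrow>
     lex_greater G \<Lambda>a \<Lambda>b \<or> (\<forall>k \<in> lex_indices G. rho G k \<Lambda>a = rho G k \<Lambda>b)"

definition is_lexmax :: "'v bigraph \<Rightarrow> 'v interval_array set \<Rightarrow> 'v interval_array \<Rightarrow> bool" where
  "is_lexmax G I \<Lambda> \<longleftrightarrow> \<Lambda> \<in> I \<and> (\<forall>\<Lambda>' \<in> I. lex_geq G \<Lambda> \<Lambda>')"


subsection \<open>The Assignment Sensitivity Algorithm\<close>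

definition bound_value :: "ereal \<Rightarrow> ereal \<Rightarrow> ereal \<Rightarrow> ereal \<Rightarrow> ereal" where
  "bound_value we we' up lo =
     (if up = \<infinity> \<and> lo = \<infinity> then (we' - we) / 2
      else if up = \<infinity> \<and> lo \<noteq> \<infinity> then we' - lo - we
      else if up \<noteq> \<infinity> \<and> lo = \<infinity> then we' - we - up
      else if we + up \<le> we' - lo then \<infinity> else - \<infinity>)"

definition asa_init :: "'v interval_array" where
  "asa_init = \<lparr>lower = (\<lambda>_. \<infinity>), upper = (\<lambda>_. \<infinity>)\<rparr>"

definition asa_weights ::
  "('v \<times> 'v \<Rightarrow> ereal) \<Rightarrow> 'v interval_array \<Rightarrow> 'v \<times> 'v \<Rightarrow> 'v \<times> 'v \<Rightarrow> ereal" where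
  "asa_weights W \<Lambda> e e' =
     (if e' = e then \<infinity> else bound_value (W e) (W e') (upper \<Lambda> e) (lower \<Lambda> e'))"

text \<open>The choices made in one iteration are nondeterministic: \<open>b\<close> picks a bottleneck
  edge for every edge of the assignment, and \<open>d\<close> is the edge at which the minimum
  is attained.\<close>

definition asa_choice ::
  "'v bigraph \<Rightarrow> ('v \<times> 'v \<Rightarrow> ereal) \<Rightarrow> ('v \<times> 'v) set \<Rightarrow> 'v interval_array \<Rightarrow>
   ('v \<times> 'v \<Rightarrow> 'v \<times> 'v) \<Rightarrow> 'v \<times> 'v \<Rightarrow> bool" where
  "asa_choice G W \<Pi> \<Lambda> b d \<longleftrightarrow>
     (\<forall>e \<in> \<Pi>. b e \<in> bottleneck_edges G (asa_weights W \<Lambda> e)) \<and>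
     is_arg_min (\<lambda>e. asa_weights W \<Lambda> e (b e)) (\<lambda>e. e \<in> \<Pi>) d"

definition asa_update ::
  "'v interval_array \<Rightarrow> 'v \<times> 'v \<Rightarrow> 'v \<times> 'v \<Rightarrow> ereal \<Rightarrow> 'v interval_array" where
  "asa_update \<Lambda> d c x =
     \<lparr>lower = (if lower \<Lambda> c = \<infinity> then (lower \<Lambda>)(c := x) else lower \<Lambda>),
      upper = (if upper \<Lambda> d = \<infinity> then (upper \<Lambda>)(d := x) else upper \<Lambda>)\<rparr>"

definition asa_step ::
  "'v bigraph \<Rightarrow> ('v \<times> 'v \<Rightarrow> ereal) \<Rightarrow> ('v \<times> 'v) set \<Rightarrow>
   'v interval_array \<Rightarrow> 'v interval_array \<Rightarrow> bool" where
  "asa_step G W \<Pi> \<Lambda> \<Lambda>' \<longleftrightarrow>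
     (\<exists>b d. asa_choice G W \<Pi> \<Lambda> b d \<and> asa_weights W \<Lambda> d (b d) \<noteq> \<infinity> \<and>
        \<Lambda>' = asa_update \<Lambda> d (b d) (asa_weights W \<Lambda> d (b d)))"

definition asa_stops ::
  "'v bigraph \<Rightarrow> ('v \<times> 'v \<Rightarrow> ereal) \<Rightarrow> ('v \<times> 'v) set \<Rightarrow> 'v interval_array \<Rightarrow> bool" where
  "asa_stops G W \<Pi> \<Lambda> \<longleftrightarrow>
     (\<exists>b d. asa_choice G W \<Pi> \<Lambda> b d \<and> asa_weights W \<Lambda> d (b d) = \<infinity>)"

text \<open>\<open>L 0, \<dots>, L N\<close> are the successive values of the bounds in a complete execution
  that returns \<open>L N\<close>.\<close>

definition asa_execution ::
  "'v bigraph \<Rightarrow> ('v \<times> 'v \<Rightarrow> ereal) \<Rightarrow> ('v \<times> 'v) set \<Rightarrow>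
   (nat \<Rightarrow> 'v interval_array) \<Rightarrow> nat \<Rightarrow> bool" where
  "asa_execution G W \<Pi> L N \<longleftrightarrow>
     L 0 = asa_init \<and> (\<forall>k < N. asa_step G W \<Pi> (L k) (L (Suc k))) \<and> asa_stops G W \<Pi> (L N)"

text \<open>Uniqueness is required of every weight function constructed during the execution
  whose bottleneck value is not \<open>\<infinity>\<close>.  It must not be required when that value
  is \<open>\<infinity>\<close>: once an iteration has set a bound at \<open>d\<close> and \<open>b d\<close>, the weights
  built from \<open>d\<close> in the last iteration always have both \<open>d\<close> and \<open>b d\<close> as
  bottleneck edges, so the unrestricted condition would exclude every execution that
  sets a bound.\<close>

definition asa_unique ::
  "'v bigraph \<Rightarrow> ('v \<times> 'v \<Rightarrow> ereal) \<Rightarrow> ('v \<times> 'v) set \<Rightarrow>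
   (nat \<Rightarrow> 'v interval_array) \<Rightarrow> nat \<Rightarrow> bool" where
  "asa_unique G W \<Pi> L N \<longleftrightarrow>
     (\<forall>k \<le> N. \<forall>e \<in> \<Pi>. (\<exists>A \<in> BAP G (asa_weights W (L k) e).
           bottleneck (asa_weights W (L k) e) A \<noteq> \<infinity>) \<longrightarrow>
        (\<exists>!c. c \<in> bottleneck_edges G (asa_weights W (L k) e)))"

end

theory Submission
  imports Defs
begin

text \<open>Call the finite bounds of an intermediate array determined.  Replacing the undetermined
  ones by a common value \<open>t\<close> gives an array in \<open>LA\<close> exactly when \<open>t\<close> is at most the value \<open>x\<close>
  computed in the current iteration.  By uniqueness, some assignment avoiding the chosen edge
  \<open>d\<close> of \<open>\<Pi>\<close> can only be kept from beating \<open>\<Pi>\<close> through its edge \<open>c = b d\<close>, unless an undetermined bound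
  is made smaller than \<open>x\<close>.  So an array in \<open>LA\<close> that shares the determined bounds either
  has another bound below \<open>x\<close>, and is lexicographically smaller than the output, or also
  shares the bounds that the iteration determines.\<close>

subsection \<open>Lexicographic comparison of sorted values\<close>

lemma sorted_nth_le_iff:
  fixes v :: "'a::linorder"
  assumes "sorted xs" "i < length xs"
  shows "xs ! i \<le> v \<longleftrightarrow> i < length (filter (\<lambda>x. x \<le> v) xs)"
  using assms
proof (induction xs arbitrary: i)
  case (Cons x xs)
  show ?case
  proof (cases "x \<le> v")
    case True
    then show ?thesis using Cons by (cases i) auto
  next
    case False
    then have "\<forall>y \<in> set (x # xs). \<not> y \<le> v" using Cons.prems by auto
    then show ?thesis using Cons.prems(2) nth_mem by (metis filter_False list.size(3) not_less0)
  qed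
qed simp

abbreviation sorted_values :: "('a \<Rightarrow> 'b::linorder) \<Rightarrow> 'a set \<Rightarrow> 'b list" where
  "sorted_values f S \<equiv> sorted_list_of_multiset (image_mset f (mset_set S))"

lemma length_sorted_values: "length (sorted_values f S) = card S"
  by (metis mset_sorted_list_of_multiset size_image_mset size_mset size_mset_set)

text \<open>Order statistics are compared below only through sizes of sublevel sets, so no sorting
  permutation has to be tracked.\<close>

lemma sorted_values_nth_le_iff:
  assumes "finite S" "i < card S"
  shows "sorted_values f S ! i \<le> v \<longleftrightarrow> i < card {p \<in> S. f p \<le> v}"
proof -
  have "length (filter (\<lambda>x. x \<le> v) (sorted_values f S))
      = size (filter_mset (\<lambda>x. x \<le> v) (image_mset f (mset_set S)))"
    by (metis mset_filter mset_sorted_list_of_multiset size_mset)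
  also have "\<dots> = card {p \<in> S. f p \<le> v}"
    using assms(1) by (simp add: filter_mset_image_mset)
  finally show ?thesis
    using sorted_nth_le_iff[of "sorted_values f S" i v] assms(2)
    by (simp add: length_sorted_values)
qed

lemma sorted_values_nth_mono:
  assumes "finite S" "i < card S" "\<And>p. p \<in> S \<Longrightarrow> g p \<le> f p"
  shows "sorted_values g S ! i \<le> sorted_values f S ! i"
proof -
  let ?v = "sorted_values f S ! i"
  have "i < card {p \<in> S. f p \<le> ?v}"
    using sorted_values_nth_le_iff[OF assms(1,2), of f ?v] by simp
  also have "\<dots> \<le> card {p \<in> S. g p \<le> ?v}"
    using assms(1,3) by (intro card_mono) (auto intro: order_trans)
  finally show ?thesis using sorted_values_nth_le_iff[OF assms(1,2)] by blast
qed

text \<open>Let \<open>y\<close> be the least value of \<open>g\<close> outside \<open>F\<close>.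
  Below \<open>y\<close> both functions have the same sublevel sets, since only points of
  \<open>F\<close> contribute; at \<open>y\<close> the sublevel set of \<open>g\<close> is strictly
  larger. So the sorted lists first differ where \<open>g\<close> has a value \<le> \<open>y\<close>
  and \<open>f\<close> a larger one.\<close>

lemma sorted_values_lex_less:
  fixes f g :: "'a \<Rightarrow> 'b::linorder"
  assumes "finite S" and q: "q \<in> S - F" "g q < x"
    and agree: "\<And>p. p \<in> S \<inter> F \<Longrightarrow> f p = g p"
    and above: "\<And>p. p \<in> S - F \<Longrightarrow> x \<le> f p"
  shows "\<exists>j < card S. sorted_values g S ! j < sorted_values f S ! j \<and>
    (\<forall>i < j. sorted_values g S ! i = sorted_values f S ! i)"
proof -
  define y where "y = Min (g ` (S - F))"
  have y_le: "y \<le> g p" if "p \<in> S - F" for p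
    using that assms(1) by (simp add: y_def)
  obtain r where r: "r \<in> S - F" "g r = y"
    using Min_in[of "g ` (S - F)"] assms(1) q(1) unfolding y_def by fastforce
  have "y < x" using y_le[OF q(1)] q(2) by simp
  \<comment> \<open>Counted from 0, \<open>j\<close> is the position of the first sorted value of
    \<open>f\<close> above \<open>y\<close>.\<close>
  define j where "j = card {p \<in> S. f p \<le> y}"
  have f_low: "{p \<in> S. f p \<le> v} = {p \<in> S \<inter> F. g p \<le> v}" if "v < x" for v
    using that agree above by fastforce
  have g_low: "{p \<in> S. g p \<le> v} = {p \<in> S \<inter> F. g p \<le> v}" if "v < y" for v
    using that y_le by fastforce
  have j_lt: "j < card {p \<in> S. g p \<le> y}"
    unfolding j_def f_low[OF \<open>y < x\<close>] using assms(1) r by (intro psubset_card_mono) auto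
  also have "\<dots> \<le> card S" using assms(1) by (intro card_mono) auto
  finally have "j < card S" .
  show ?thesis
  proof (intro exI[of _ j] conjI allI impI)
    show "j < card S" by fact
    have "sorted_values g S ! j \<le> y" "\<not> sorted_values f S ! j \<le> y"
      using j_lt unfolding sorted_values_nth_le_iff[OF assms(1) \<open>j < card S\<close>]
      by (simp_all add: j_def)
    then show "sorted_values g S ! j < sorted_values f S ! j" by simp
    fix i assume "i < j"
    then have "i < card S" using \<open>j < card S\<close> by simp
    note le_iff = sorted_values_nth_le_iff[OF assms(1) this]
    \<comment> \<open>Entries with the same upper thresholds \<open>v\<close> are equal. Thresholds
      \<ge> \<open>y\<close> are trivial, as both entries are \<le> \<open>y\<close>.\<close>
    have "sorted_values g S ! i \<le> v \<longleftrightarrow> sorted_values f S ! i \<le> v" for v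
    proof (cases "v < y")
      case True
      then show ?thesis using f_low[of v] g_low \<open>y < x\<close> by (simp add: le_iff)
    next
      case False
      have "sorted_values g S ! i \<le> y" "sorted_values f S ! i \<le> y"
        using j_lt \<open>i < j\<close> unfolding le_iff by (simp_all add: j_def)
      then show ?thesis using False by auto
    qed
    then show "sorted_values g S ! i = sorted_values f S ! i" by (metis order_antisym order_refl)
  qed
qed


subsection \<open>Arrays as functions on the set of bounds\<close>

text \<open>The disjoint sum keeps the two bounds of an edge apart, so multiplicities survive and
  lower and upper bounds are treated alike.\<close>

definition bound :: "'v interval_array \<Rightarrow> ('v \<times> 'v) + ('v \<times> 'v) \<Rightarrow> ereal" where
  "bound \<Lambda> = case_sum (lower \<Lambda>) (upper \<Lambda>)"

lemma bound_simps [simp]: "bound \<Lambda> (Inl e) = lower \<Lambda> e" "bound \<Lambda> (Inr e) = upper \<Lambda> e"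
  by (simp_all add: bound_def)

abbreviation bounds :: "'v bigraph \<Rightarrow> (('v \<times> 'v) + ('v \<times> 'v)) set" where
  "bounds G \<equiv> edges G <+> edges G"

lemma mem_L0_iff: "\<Lambda> \<in> L0 G \<longleftrightarrow> (\<forall>p \<in> bounds G. 0 \<le> bound \<Lambda> p)"
  by (auto simp: L0_def in_array_def Plus_def ball_Un)

lemma L0_bounds:
  assumes "\<Lambda> \<in> L0 G" "e \<in> edges G"
  shows "0 \<le> lower \<Lambda> e" "0 \<le> upper \<Lambda> e"
  using assms by (auto simp: L0_def in_array_def)

text \<open>On \<open>L0\<close> the absolute values disappear: \<open>lower\<close> is stored with
  its sign flipped, so both fields are nonnegative.\<close>

lemma bound_magnitudes_L0:
  assumes "finite (edges G)" "\<Lambda> \<in> L0 G"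
  shows "bound_magnitudes G \<Lambda> = sorted_values (bound \<Lambda>) (bounds G)"
proof -
  have "mset_set (bounds G) = image_mset Inl (mset_set (edges G)) + image_mset Inr (mset_set (edges G))"
    unfolding Plus_def using assms(1)
    by (subst mset_set_Union) (auto simp: image_mset_mset_set)
  moreover have "image_mset (\<lambda>e. \<bar>- lower \<Lambda> e\<bar>) (mset_set (edges G))
      = image_mset (lower \<Lambda>) (mset_set (edges G))"
    "image_mset (\<lambda>e. \<bar>upper \<Lambda> e\<bar>) (mset_set (edges G)) = image_mset (upper \<Lambda>) (mset_set (edges G))"
    using assms by (auto intro!: image_mset_cong simp: L0_bounds)
  ultimately show ?thesis
    by (simp add: bound_magnitudes_def image_mset.compositionality comp_def)
qed

lemma rho_L0:
  assumes "finite (edges G)" "\<Lambda> \<in> L0 G"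
  shows "rho G k \<Lambda> = (if k \<le> card (bounds G) then sorted_values (bound \<Lambda>) (bounds G) ! (k - 1) else \<infinity>)"
  by (simp add: rho_def Let_def bound_magnitudes_L0[OF assms] length_sorted_values)

text \<open>Order statistics are monotone, so at the first index where \<open>rho\<close> differs
  the pointwise larger array has the larger value.\<close>

lemma lex_geqI_pointwise:
  assumes fin: "finite (edges G)" and "\<Lambda> \<in> L0 G" "\<Lambda>' \<in> L0 G"
    and le: "\<And>p. p \<in> bounds G \<Longrightarrow> bound \<Lambda>' p \<le> bound \<Lambda> p"
  shows "lex_geq G \<Lambda> \<Lambda>'"
proof (cases "\<forall>k \<in> lex_indices G. rho G k \<Lambda> = rho G k \<Lambda>'")
  case False
  define i where "i = (LEAST k. k \<in> lex_indices G \<and> rho G k \<Lambda> \<noteq> rho G k \<Lambda>')"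
  have i: "i \<in> lex_indices G" "rho G i \<Lambda> \<noteq> rho G i \<Lambda>'"
    using LeastI_ex[of "\<lambda>k. k \<in> lex_indices G \<and> rho G k \<Lambda> \<noteq> rho G k \<Lambda>'"] False
    unfolding i_def by auto
  have below: "\<forall>k \<in> lex_indices G. k < i \<longrightarrow> rho G k \<Lambda> = rho G k \<Lambda>'"
    using not_less_Least[of _ "\<lambda>k. k \<in> lex_indices G \<and> rho G k \<Lambda> \<noteq> rho G k \<Lambda>'"]
    unfolding i_def by blast
  have "1 \<le> i" using i(1) by (simp add: lex_indices_def)
  have "rho G i \<Lambda>' \<le> rho G i \<Lambda>"
  \<comment> \<open>Past the number of bounds, \<open>rho\<close> has the default value \<infinity>
    for both arrays.\<close>
  proof (cases "i \<le> card (bounds G)")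
    case True
    then have "i - 1 < card (bounds G)" using \<open>1 \<le> i\<close> by simp
    from sorted_values_nth_mono[OF _ this, of "bound \<Lambda>'" "bound \<Lambda>"] show ?thesis
      using fin le assms(2,3) True by (simp add: rho_L0)
  qed (use assms in \<open>simp add: rho_L0\<close>)
  then have "rho G i \<Lambda>' < rho G i \<Lambda>" using i(2) by simp
  then show ?thesis using i(1) below unfolding lex_geq_def lex_greater_def by blast
qed (simp add: lex_geq_def)

lemma lex_geqI_smaller_bound:
  assumes fin: "finite (edges G)" and L0: "\<Lambda> \<in> L0 G" "\<Lambda>' \<in> L0 G"
    and q: "q \<in> bounds G - F" "bound \<Lambda>' q < x"
    and agree: "\<And>p. p \<in> bounds G \<inter> F \<Longrightarrow> bound \<Lambda> p = bound \<Lambda>' p"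
    and above: "\<And>p. p \<in> bounds G - F \<Longrightarrow> x \<le> bound \<Lambda> p"
  shows "lex_geq G \<Lambda> \<Lambda>'"
proof -
  obtain j where j: "j < card (bounds G)"
    "sorted_values (bound \<Lambda>') (bounds G) ! j < sorted_values (bound \<Lambda>) (bounds G) ! j"
    "\<And>i. i < j \<Longrightarrow> sorted_values (bound \<Lambda>') (bounds G) ! i = sorted_values (bound \<Lambda>) (bounds G) ! i"
    using sorted_values_lex_less[of "bounds G" q F "bound \<Lambda>'" x "bound \<Lambda>"] fin q agree above by auto
  have less: "rho G (Suc j) \<Lambda>' < rho G (Suc j) \<Lambda>"
    using j fin L0 by (simp add: rho_L0)
  have eq: "rho G k \<Lambda> = rho G k \<Lambda>'" if "k \<in> lex_indices G" "k < Suc j" for k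
  proof -
    have "k - 1 < j" "k \<le> card (bounds G)" using that j(1) by (auto simp: lex_indices_def)
    then show ?thesis using j(3)[of "k - 1"] fin L0 by (simp add: rho_L0)
  qed
  show ?thesis
  \<comment> \<open>There may be up to twice as many bounds as indices, so the first difference can
    lie past the last compared index. All compared values then agree, and the non-strict order still
    holds.\<close>
  proof (cases "Suc j \<in> lex_indices G")
    case True
    then show ?thesis using less eq by (auto simp: lex_geq_def lex_greater_def)
  next
    case False
    then have "\<forall>k \<in> lex_indices G. k < Suc j" by (auto simp: lex_indices_def)
    then show ?thesis using eq by (auto simp: lex_geq_def)
  qed
qed


subsection \<open>Common values for the undetermined bounds\<close>

definition fill :: "ereal \<Rightarrow> ereal \<Rightarrow> ereal" where
  "fill t x = (if x = \<infinity> then t else x)"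

text \<open>Determined bounds are kept even when they exceed \<open>t\<close>, so this is not a
  pointwise minimum.\<close>

definition capped :: "'v interval_array \<Rightarrow> ereal \<Rightarrow> 'v interval_array" where
  "capped \<Lambda> t = \<lparr>lower = (\<lambda>e. fill t (lower \<Lambda> e)), upper = (\<lambda>e. fill t (upper \<Lambda> e))\<rparr>"

lemma capped_simps [simp]:
  "lower (capped \<Lambda> t) e = fill t (lower \<Lambda> e)"
  "upper (capped \<Lambda> t) e = fill t (upper \<Lambda> e)"
  by (simp_all add: capped_def)

lemma bound_capped [simp]: "bound (capped \<Lambda> t) p = fill t (bound \<Lambda> p)"
  by (cases p) simp_all

lemma capped_L0: "\<Lambda> \<in> L0 G \<Longrightarrow> 0 \<le> t \<Longrightarrow> capped \<Lambda> t \<in> L0 G"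
  by (auto simp: mem_L0_iff fill_def)

lemma bound_asa_update:
  "bound (asa_update \<Lambda> d c x) p = (if p \<in> {Inl c, Inr d} then fill x (bound \<Lambda> p) else bound \<Lambda> p)"
  by (cases p) (auto simp: asa_update_def fill_def)

text \<open>Each case of \<open>bound_value\<close> solves the inequality on the right for the
  common value \<open>t\<close> of the undetermined bounds; the division by 2 occurs when both sides
  move with \<open>t\<close>.\<close>

lemma le_bound_value_iff:
  assumes "we \<noteq> -\<infinity>" "0 \<le> up" "0 \<le> lo" "0 \<le> t" "t \<noteq> \<infinity>"
  shows "t \<le> bound_value we we' up lo \<longleftrightarrow> we + fill t up \<le> we' - fill t lo"
  using assms
  by (cases we; cases we'; cases up; cases lo; cases t) (auto simp: bound_value_def fill_def)

text \<open>If a bound is undetermined, the value \<infinity> forces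
  \<open>we' = \<infinity>\<close>, and then \<open>we' - lo = \<infinity>\<close> even for
  \<open>lo = \<infinity>\<close>, since \<infinity> - \<infinity> = \<infinity> in
  \<open>ereal\<close>.\<close>

lemma bound_value_top:
  assumes "we \<noteq> -\<infinity>" "0 \<le> up" "0 \<le> lo" "bound_value we we' up lo = \<infinity>"
  shows "we + up \<le> we' - lo"
  using assms
  by (cases we; cases we'; cases up; cases lo) (auto simp: bound_value_def split: if_splits)

text \<open>At \<open>x\<close> the inequality for the filled bounds is an equality of finite
  numbers, so raising either bound would violate it.\<close>

lemma bound_value_tight:
  assumes "we \<noteq> -\<infinity>" "0 \<le> up" "0 \<le> lo"
    and x: "x = bound_value we we' up lo" "0 \<le> x" "x \<noteq> \<infinity>"
    and le: "we + up' \<le> we' - lo'" "fill x up \<le> up'" "fill x lo \<le> lo'"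
  shows "up = \<infinity> \<Longrightarrow> up' = x" "lo = \<infinity> \<Longrightarrow> lo' = x"
proof -
  \<comment> \<open>With both bounds determined the value would be \<infinity> or
    -\<infinity>.\<close>
  have undetermined: "up = \<infinity> \<or> lo = \<infinity>"
    using x by (auto simp: bound_value_def split: if_splits)
  obtain r where r: "x = ereal r" using x(2,3) by (cases x) auto
  obtain a where a: "we = ereal a"
    using assms(1-3) x by (cases we; cases we'; cases up; cases lo) (auto simp: bound_value_def)
  obtain a' where a': "we' = ereal a'"
    using assms(2,3) x a by (cases we'; cases up; cases lo) (auto simp: bound_value_def)
  have nonneg: "0 \<le> up'" "0 \<le> lo'"
    using le(2,3) assms(2,3) x(2) by (auto simp: fill_def split: if_splits)
  obtain u where u: "up' = ereal u"
    using le(1) nonneg a a' by (cases up'; cases lo') auto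
  obtain l where l: "lo' = ereal l"
    using le(1) nonneg a a' u by (cases lo') auto
  show "up = \<infinity> \<Longrightarrow> up' = x" "lo = \<infinity> \<Longrightarrow> lo' = x"
    using assms(2,3) undetermined x(1) le
    unfolding r a a' u l
    by (cases up; cases lo; auto simp: bound_value_def fill_def)+
qed


subsection \<open>Correctness of the algorithm\<close>

context
  fixes G :: "'v bigraph" and W :: "'v \<times> 'v \<Rightarrow> ereal" and \<Pi> :: "('v \<times> 'v) set"
  assumes bip: "bipartite_graph G"
    and W_\<Pi>: "\<forall>e \<in> \<Pi>. W e \<noteq> -\<infinity>"
    and \<Pi>_assignment: "\<Pi> \<in> assignments G"
begin

section \<open>Assignments and their bottleneck values\<close>

lemma finite_edges: "finite (edges G)"
  using bip unfolding bipartite_graph_def by (meson finite_SigmaI finite_subset)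

lemma assignment_edges: "A \<in> assignments G \<Longrightarrow> e \<in> A \<Longrightarrow> e \<in> edges G"
  by (auto simp: assignments_def)

lemma finite_assignment: "A \<in> assignments G \<Longrightarrow> finite A"
  using finite_edges by (auto simp: assignments_def intro: finite_subset)

lemma assignment_nonempty:
  assumes "A \<in> assignments G"
  shows "A \<noteq> {}"
proof -
  have "rpart G \<noteq> {}" using bip by (auto simp: bipartite_graph_def)
  then show ?thesis using assms by (auto simp: assignments_def)
qed

lemma le_bottleneck_iff:
  "A \<in> assignments G \<Longrightarrow> t \<le> bottleneck w A \<longleftrightarrow> (\<exists>e \<in> A. t \<le> w e)"
  by (simp add: bottleneck_def Max_ge_iff finite_assignment assignment_nonempty)

lemma le_bottleneck: "A \<in> assignments G \<Longrightarrow> e \<in> A \<Longrightarrow> w e \<le> bottleneck w A"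
  using le_bottleneck_iff by blast

lemma bottleneck_le_iff:
  "A \<in> assignments G \<Longrightarrow> bottleneck w A \<le> t \<longleftrightarrow> (\<forall>e \<in> A. w e \<le> t)"
  by (simp add: bottleneck_def finite_assignment assignment_nonempty)

lemma mem_BAP_iff:
  "A \<in> BAP G w \<longleftrightarrow> A \<in> assignments G \<and> (\<forall>A' \<in> assignments G. bottleneck w A \<le> bottleneck w A')"
  by (auto simp: BAP_def is_arg_min_linorder)

text \<open>The worst case for \<open>e\<close> against \<open>A\<close> raises \<open>e\<close> to
  its upper bound and lowers all edges of \<open>A\<close> as far as possible. If \<open>A\<close>
  contains \<open>e\<close>, its bottleneck is at least the perturbed weight of \<open>e\<close> in
  any case.\<close>

lemma mem_LA_iff:
  assumes "\<Lambda> \<in> L0 G"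
  shows "\<Lambda> \<in> LA G W \<Pi> \<longleftrightarrow>
    (\<forall>e \<in> \<Pi>. \<forall>A \<in> assignments G. e \<in> A \<or> (\<exists>e' \<in> A. W e + upper \<Lambda> e \<le> W e' - lower \<Lambda> e'))"
proof (intro iffI ballI)
  fix e A assume LA: "\<Lambda> \<in> LA G W \<Pi>" and e: "e \<in> \<Pi>" and A: "A \<in> assignments G"
  show "e \<in> A \<or> (\<exists>e' \<in> A. W e + upper \<Lambda> e \<le> W e' - lower \<Lambda> e')"
  proof (cases "e \<in> A")
    case False
    \<comment> \<open>This extremal perturbation lies in the array because lower ends are \<le> 0
      and upper ends \<ge> 0. Lowering the other edges of \<open>\<Pi>\<close> does no harm: only
      the weight of \<open>e\<close> is compared.\<close>
    define P where "P = (\<lambda>e'. if e' = e then upper \<Lambda> e else - lower \<Lambda> e')"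
    have "in_array G P \<Lambda>"
      unfolding in_array_def P_def
      using L0_bounds[OF assms] by (auto intro: order_trans[of _ 0])
    then have "\<Pi> \<in> BAP G (\<lambda>e. W e + P e)" using LA by (simp add: LA_def)
    then have "W e + P e \<le> bottleneck (\<lambda>e. W e + P e) A"
      using A e by (auto simp: mem_BAP_iff bottleneck_le_iff)
    then obtain e' where "e' \<in> A" "W e + P e \<le> W e' + P e'"
      using A by (auto simp: le_bottleneck_iff)
    then have "W e + upper \<Lambda> e \<le> W e' - lower \<Lambda> e'"
      using False by (auto simp: P_def minus_ereal_def split: if_splits)
    then show ?thesis using \<open>e' \<in> A\<close> by blast
  qed simp
next
  assume cond: "\<forall>e \<in> \<Pi>. \<forall>A \<in> assignments G.
    e \<in> A \<or> (\<exists>e' \<in> A. W e + upper \<Lambda> e \<le> W e' - lower \<Lambda> e')"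
  have "W e + P e \<le> bottleneck (\<lambda>e. W e + P e) A"
    if P: "in_array G P \<Lambda>" and e: "e \<in> \<Pi>" and A: "A \<in> assignments G" for P e A
  proof (cases "e \<in> A")
    case True
    then show ?thesis using le_bottleneck[OF A, of e "\<lambda>e. W e + P e"] by simp
  next
    case False
    then obtain e' where e': "e' \<in> A" "W e + upper \<Lambda> e \<le> W e' - lower \<Lambda> e'"
      using cond e A by blast
    have "W e + P e \<le> W e + upper \<Lambda> e"
      using P assignment_edges[OF \<Pi>_assignment e] by (auto simp: in_array_def intro!: add_left_mono)
    also note e'(2)
    also have "W e' - lower \<Lambda> e' \<le> W e' + P e'"
      using P assignment_edges[OF A e'(1)] by (auto simp: in_array_def minus_ereal_def intro!: add_left_mono)
    finally show ?thesis using A e'(1) le_bottleneck_iff by blast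
  qed
  then show "\<Lambda> \<in> LA G W \<Pi>"
    using \<Pi>_assignment by (auto simp: LA_def mem_BAP_iff bottleneck_le_iff)
qed

text \<open>A bottleneck edge attains the bottleneck value, so the computed value is a minimum over
  \<open>\<Pi>\<close> and over assignments of a maximum over edges. In particular it does not
  depend on the choices \<open>b\<close> and \<open>d\<close>.\<close>

lemma asa_choice_le_iff:
  assumes "asa_choice G W \<Pi> \<Lambda> b d"
  shows "t \<le> asa_weights W \<Lambda> d (b d) \<longleftrightarrow>
    (\<forall>e \<in> \<Pi>. \<forall>A \<in> assignments G. \<exists>e' \<in> A. t \<le> asa_weights W \<Lambda> e e')"
proof -
  have d: "d \<in> \<Pi>" "\<And>e. e \<in> \<Pi> \<Longrightarrow> asa_weights W \<Lambda> d (b d) \<le> asa_weights W \<Lambda> e (b e)"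
    using assms by (auto simp: asa_choice_def is_arg_min_linorder)
  have "t \<le> asa_weights W \<Lambda> e (b e) \<longleftrightarrow> (\<forall>A \<in> assignments G. t \<le> bottleneck (asa_weights W \<Lambda> e) A)"
    if "e \<in> \<Pi>" for e
  proof -
    have "b e \<in> bottleneck_edges G (asa_weights W \<Lambda> e)"
      using assms that by (simp add: asa_choice_def)
    then obtain A where A: "A \<in> BAP G (asa_weights W \<Lambda> e)"
      and eq: "asa_weights W \<Lambda> e (b e) = bottleneck (asa_weights W \<Lambda> e) A"
      unfolding bottleneck_edges_def mem_Collect_eq by (elim bexE conjE)
    have min: "A \<in> assignments G"
      "\<forall>A' \<in> assignments G. bottleneck (asa_weights W \<Lambda> e) A \<le> bottleneck (asa_weights W \<Lambda> e) A'"
      using A by (simp_all add: mem_BAP_iff)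
    show ?thesis
      unfolding eq
    proof (intro iffI ballI)
      fix A' assume "t \<le> bottleneck (asa_weights W \<Lambda> e) A" "A' \<in> assignments G"
      then show "t \<le> bottleneck (asa_weights W \<Lambda> e) A'" using min(2) order_trans by blast
    qed (use min(1) in blast)
  qed
  then have "(\<forall>e \<in> \<Pi>. t \<le> asa_weights W \<Lambda> e (b e)) \<longleftrightarrow>
      (\<forall>e \<in> \<Pi>. \<forall>A \<in> assignments G. \<exists>e' \<in> A. t \<le> asa_weights W \<Lambda> e e')"
    by (simp add: le_bottleneck_iff)
  moreover have "t \<le> asa_weights W \<Lambda> d (b d) \<longleftrightarrow> (\<forall>e \<in> \<Pi>. t \<le> asa_weights W \<Lambda> e (b e))"
    using d(1) by (auto intro: order_trans[OF _ d(2)])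
  ultimately show ?thesis by simp
qed

text \<open>Both sides unfold to the same condition on pairs of edges by
  \<open>le_bound_value_iff\<close>. The entry \<infinity> of \<open>asa_weights\<close> at
  \<open>e\<close> itself supplies the disjunct \<open>e \<in> A\<close> of
  \<open>mem_LA_iff\<close>.\<close>

lemma capped_LA_iff:
  assumes "asa_choice G W \<Pi> \<Lambda> b d" "\<Lambda> \<in> L0 G" "0 \<le> t" "t \<noteq> \<infinity>"
  shows "capped \<Lambda> t \<in> LA G W \<Pi> \<longleftrightarrow> t \<le> asa_weights W \<Lambda> d (b d)"
proof -
  have "t \<le> asa_weights W \<Lambda> e e' \<longleftrightarrow>
      e' = e \<or> W e + fill t (upper \<Lambda> e) \<le> W e' - fill t (lower \<Lambda> e')"
    if "e \<in> \<Pi>" "A \<in> assignments G" "e' \<in> A" for e e' A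
  proof -
    have "e \<in> edges G" "e' \<in> edges G" using that \<Pi>_assignment assignment_edges by blast+
    then have "0 \<le> upper \<Lambda> e" "0 \<le> lower \<Lambda> e'" using assms(2) L0_bounds by blast+
    then show ?thesis
      using le_bound_value_iff[of "W e"] W_\<Pi> that(1) assms(3,4) by (simp add: asa_weights_def)
  qed
  then have "(\<exists>e' \<in> A. t \<le> asa_weights W \<Lambda> e e') \<longleftrightarrow>
      e \<in> A \<or> (\<exists>e' \<in> A. W e + fill t (upper \<Lambda> e) \<le> W e' - fill t (lower \<Lambda> e'))"
    if "e \<in> \<Pi>" "A \<in> assignments G" for e A
    using that by (simp cong: bex_cong) blast
  then show ?thesis
    by (simp add: mem_LA_iff[OF capped_L0[OF assms(2,3)]] asa_choice_le_iff[OF assms(1)])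
qed

text \<open>The threshold \<open>t = \<infinity>\<close> in \<open>asa_choice_le_iff\<close> gives
  the criterion with the remaining infinite bounds taken literally.\<close>

lemma asa_stops_LA:
  assumes "asa_stops G W \<Pi> \<Lambda>" "\<Lambda> \<in> L0 G"
  shows "\<Lambda> \<in> LA G W \<Pi>"
  unfolding mem_LA_iff[OF assms(2)]
proof (intro ballI)
  fix e A assume e: "e \<in> \<Pi>" and A: "A \<in> assignments G"
  obtain b d where "asa_choice G W \<Pi> \<Lambda> b d" "\<infinity> \<le> asa_weights W \<Lambda> d (b d)"
    using assms(1) by (auto simp: asa_stops_def)
  then obtain e' where e': "e' \<in> A" "\<infinity> \<le> asa_weights W \<Lambda> e e'"
    using asa_choice_le_iff e A by blast
  have "W e + upper \<Lambda> e \<le> W e' - lower \<Lambda> e'" if "e' \<noteq> e"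
  proof (rule bound_value_top)
    show "W e \<noteq> -\<infinity>" using W_\<Pi> e by blast
    show "0 \<le> upper \<Lambda> e" "0 \<le> lower \<Lambda> e'"
      using L0_bounds[OF assms(2)] assignment_edges \<Pi>_assignment e A e'(1) by blast+
    show "bound_value (W e) (W e') (upper \<Lambda> e) (lower \<Lambda> e') = \<infinity>"
      using e'(2) that by (simp add: asa_weights_def)
  qed
  then show "e \<in> A \<or> (\<exists>e' \<in> A. W e + upper \<Lambda> e \<le> W e' - lower \<Lambda> e')" using e'(1) by blast
qed

text \<open>By uniqueness, \<open>b d\<close> is the only edge of weight \<ge> \<open>x\<close> in a
  bottleneck assignment \<open>A\<close> for the weights of \<open>d\<close>. An array in
  \<open>LA\<close> must protect \<open>d\<close> against some edge of \<open>A\<close>; as its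
  bounds are at least the filled ones, that edge is \<open>b d\<close>, where the inequality is
  tight.\<close>

lemma asa_step_LA_cases:
  assumes choice: "asa_choice G W \<Pi> \<Lambda> b d" and x: "x = asa_weights W \<Lambda> d (b d)" "0 \<le> x" "x \<noteq> \<infinity>"
    and unique: "\<forall>e \<in> \<Pi>. (\<exists>A \<in> BAP G (asa_weights W \<Lambda> e). bottleneck (asa_weights W \<Lambda> e) A \<noteq> \<infinity>) \<longrightarrow>
      (\<exists>!c. c \<in> bottleneck_edges G (asa_weights W \<Lambda> e))"
    and L0: "\<Lambda> \<in> L0 G"
    and \<Lambda>': "\<Lambda>' \<in> L0 G" "\<Lambda>' \<in> LA G W \<Pi>"
    and agree: "\<And>p. p \<in> bounds G \<Longrightarrow> bound \<Lambda> p \<noteq> \<infinity> \<Longrightarrow> bound \<Lambda>' p = bound \<Lambda> p"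
    and large: "\<And>p. p \<in> bounds G \<Longrightarrow> bound \<Lambda> p = \<infinity> \<Longrightarrow> x \<le> bound \<Lambda>' p"
    and p: "p \<in> bounds G" "bound (asa_update \<Lambda> d (b d) x) p \<noteq> \<infinity>"
  shows "bound \<Lambda>' p = bound (asa_update \<Lambda> d (b d) x) p"
proof -
  let ?B = "asa_weights W \<Lambda> d"
  have d: "d \<in> \<Pi>" using choice by (simp add: asa_choice_def is_arg_min_def)
  then obtain A where A: "A \<in> BAP G ?B" "b d \<in> A" "?B (b d) = bottleneck ?B A"
    using choice by (auto simp: asa_choice_def bottleneck_edges_def)
  then have A_assignment: "A \<in> assignments G" by (simp add: mem_BAP_iff)
  have bn: "bottleneck ?B A = x" using A x by simp
  have only: "e' = b d" if "e' \<in> A" "x \<le> ?B e'" for e'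
  proof -
    have "?B e' = bottleneck ?B A"
      using that bn le_bottleneck[OF A_assignment that(1), of ?B] by simp
    then have "e' \<in> bottleneck_edges G ?B" "b d \<in> bottleneck_edges G ?B"
      using A that(1) by (auto simp: bottleneck_edges_def)
    moreover have "\<exists>!c. c \<in> bottleneck_edges G ?B"
      using unique d A(1) bn x(3) by blast
    ultimately show ?thesis by blast
  qed
  have fill_le: "fill x (bound \<Lambda> q) \<le> bound \<Lambda>' q" if "q \<in> bounds G" for q
    using agree[OF that] large[OF that] by (auto simp: fill_def)
  have d_edge: "d \<in> edges G" using d \<Pi>_assignment assignment_edges by blast
  have "d \<notin> A"
    using le_bottleneck[OF A_assignment, of d ?B] bn x(3) by (auto simp: asa_weights_def)
  then obtain e' where e': "e' \<in> A" "W d + upper \<Lambda>' d \<le> W e' - lower \<Lambda>' e'"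
    using \<Lambda>' mem_LA_iff d A_assignment by blast
  have edge: "e' \<in> edges G" "e' \<noteq> d" using e' A_assignment assignment_edges \<open>d \<notin> A\<close> by blast+
  have up: "fill x (upper \<Lambda> d) \<le> upper \<Lambda>' d" and lo: "fill x (lower \<Lambda> e') \<le> lower \<Lambda>' e'"
    using fill_le[of "Inr d"] fill_le[of "Inl e'"] d_edge edge by auto
  have nonneg: "0 \<le> upper \<Lambda> d" "0 \<le> lower \<Lambda> e'" "W d \<noteq> -\<infinity>"
    using L0_bounds[OF L0] d_edge edge(1) W_\<Pi> d by blast+
  \<comment> \<open>Shrinking the bounds of \<open>\<Lambda>'\<close> to the filled ones only
    weakens the inequality.\<close>
  have "W d + fill x (upper \<Lambda> d) \<le> W d + upper \<Lambda>' d" using up by (rule add_left_mono)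
  also note e'(2)
  also have "W e' - lower \<Lambda>' e' \<le> W e' - fill x (lower \<Lambda> e')"
    using lo by (intro ereal_minus_mono) auto
  finally have "x \<le> ?B e'"
    using le_bound_value_iff[OF nonneg(3,1,2) x(2,3)] edge(2) by (simp add: asa_weights_def)
  then have "e' = b d" using only e'(1) by blast
  then have bv: "x = bound_value (W d) (W e') (upper \<Lambda> d) (lower \<Lambda> e')"
    using x(1) edge(2) by (simp add: asa_weights_def)
  have "upper \<Lambda> d = \<infinity> \<Longrightarrow> upper \<Lambda>' d = x" "lower \<Lambda> e' = \<infinity> \<Longrightarrow> lower \<Lambda>' e' = x"
    using bound_value_tight[OF nonneg(3,1,2) bv x(2,3) e'(2) up lo] by simp_all
  then show ?thesis
    using p agree[OF p(1)] \<open>e' = b d\<close>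
    by (cases "bound \<Lambda> p = \<infinity>") (auto simp: bound_asa_update fill_def split: if_splits)
qed

text \<open>Backward induction on \<open>k\<close>: an array in \<open>LA\<close> that already has a smaller bound is compared
  with the output at once, any other one also agrees with the next intermediate array.\<close>

lemma asa_execution_lexmax:
  assumes exec: "asa_execution G W \<Pi> L N" and unique: "asa_unique G W \<Pi> L N"
    and "k \<le> N" "L k \<in> L0 G" "0 \<le> t" "t \<noteq> \<infinity>" "capped (L k) t \<in> LA G W \<Pi>"
  shows "L N \<in> L0 G \<and>
      (\<forall>p \<in> bounds G. bound (L k) p \<noteq> \<infinity> \<longrightarrow> bound (L N) p = bound (L k) p) \<and>
      (\<forall>p \<in> bounds G. bound (L k) p = \<infinity> \<longrightarrow> t \<le> bound (L N) p) \<and>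
      (\<forall>\<Lambda>' \<in> L0 G \<inter> LA G W \<Pi>.
        (\<forall>p \<in> bounds G. bound (L k) p \<noteq> \<infinity> \<longrightarrow> bound \<Lambda>' p = bound (L k) p) \<longrightarrow>
        lex_geq G (L N) \<Lambda>')"
  using assms(3-)
proof (induction k arbitrary: t rule: inc_induct)
  case base
  \<comment> \<open>Bounds of the output that are not shared are \<infinity>, so the other array is
    pointwise no larger.\<close>
  have "lex_geq G (L N) \<Lambda>'" if "\<Lambda>' \<in> L0 G"
    and agree: "\<forall>p \<in> bounds G. bound (L N) p \<noteq> \<infinity> \<longrightarrow> bound \<Lambda>' p = bound (L N) p" for \<Lambda>'
  proof (rule lex_geqI_pointwise[OF finite_edges base(1) that(1)])
    fix p assume "p \<in> bounds G"
    then show "bound \<Lambda>' p \<le> bound (L N) p"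
      using agree by (cases "bound (L N) p = \<infinity>") auto
  qed
  then show ?case using base(1) by auto
next
  case (step k)
  note L0 = step.prems(1) and t = step.prems(2-4)
  obtain b d x where choice: "asa_choice G W \<Pi> (L k) b d" and x: "x = asa_weights W (L k) d (b d)" "x \<noteq> \<infinity>"
    and next_eq: "L (Suc k) = asa_update (L k) d (b d) x"
    using exec step(2) by (auto simp: asa_execution_def asa_step_def)
  \<comment> \<open>Here \<open>t\<close> is the value of the previous iteration (0 at the start),
    so the computed values never decrease and stay nonnegative.\<close>
  have "t \<le> x" using capped_LA_iff[OF choice L0 t(1,2)] t(3) x by simp
  then have x0: "0 \<le> x" using t(1) by simp
  have "0 \<le> bound (L (Suc k)) p" if "0 \<le> bound (L k) p" for p
    using that x0 by (auto simp: next_eq bound_asa_update fill_def)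
  then have "L (Suc k) \<in> L0 G" using L0 by (simp add: mem_L0_iff)
  \<comment> \<open>The bounds set now receive \<open>x\<close> itself, so the update is invisible
    after filling with \<open>x\<close>; this carries admissibility to the next iteration.\<close>
  have "capped (L (Suc k)) x = capped (L k) x"
    by (auto simp: next_eq capped_def asa_update_def fill_def)
  moreover have "capped (L k) x \<in> LA G W \<Pi>"
    using capped_LA_iff[OF choice L0 x0 x(2)] x(1) by simp
  ultimately have "capped (L (Suc k)) x \<in> LA G W \<Pi>" by simp
  note IH = step.IH[OF \<open>L (Suc k) \<in> L0 G\<close> x0 x(2) this]
  have L0_N: "L N \<in> L0 G" using IH by blast
  have kept: "bound (L N) p = bound (L k) p" if "p \<in> bounds G" "bound (L k) p \<noteq> \<infinity>" for p
  proof -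
    have "bound (L (Suc k)) p = bound (L k) p"
      using that(2) by (auto simp: next_eq bound_asa_update fill_def)
    then show ?thesis using IH that by metis
  qed
  \<comment> \<open>An undetermined bound is set to \<open>x\<close> now, or remains undetermined
    and ends \<ge> \<open>x\<close> by the induction hypothesis.\<close>
  have above: "x \<le> bound (L N) p" if "p \<in> bounds G" "bound (L k) p = \<infinity>" for p
  proof (cases "bound (L (Suc k)) p = \<infinity>")
    case True
    then show ?thesis using IH that by blast
  next
    case False
    then have "bound (L (Suc k)) p = x"
      using that(2) by (auto simp: next_eq bound_asa_update fill_def split: if_splits)
    then show ?thesis using IH that False by (metis order_refl)
  qed
  have "lex_geq G (L N) \<Lambda>'"
    if \<Lambda>': "\<Lambda>' \<in> L0 G" "\<Lambda>' \<in> LA G W \<Pi>"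
      and agree: "\<And>p. p \<in> bounds G \<Longrightarrow> bound (L k) p \<noteq> \<infinity> \<Longrightarrow> bound \<Lambda>' p = bound (L k) p" for \<Lambda>'
  proof (cases "\<exists>q \<in> bounds G. bound (L k) q = \<infinity> \<and> bound \<Lambda>' q < x")
    case True
    \<comment> \<open>The determined bounds play the role of \<open>F\<close>.\<close>
    then obtain q where q: "q \<in> bounds G - {p. bound (L k) p \<noteq> \<infinity>}" "bound \<Lambda>' q < x" by blast
    show ?thesis
      by (rule lex_geqI_smaller_bound[OF finite_edges L0_N \<Lambda>'(1) q])
        (use kept agree above in auto)
  next
    case False
    then have large: "\<And>p. p \<in> bounds G \<Longrightarrow> bound (L k) p = \<infinity> \<Longrightarrow> x \<le> bound \<Lambda>' p"
      by (meson not_le)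
    have "\<And>p. p \<in> bounds G \<Longrightarrow> bound (L (Suc k)) p \<noteq> \<infinity> \<Longrightarrow> bound \<Lambda>' p = bound (L (Suc k)) p"
      unfolding next_eq
      by (rule asa_step_LA_cases[OF choice x(1) x0 x(2) _ L0 \<Lambda>' agree large])
        (use unique step(2) in \<open>auto simp: asa_unique_def\<close>)
    then show ?thesis using IH \<Lambda>' by blast
  qed
  then show ?case using L0_N kept above \<open>t \<le> x\<close> by (meson IntD1 IntD2 order_trans)
qed

end

theorem theorem4:
  fixes G :: "'v bigraph"
    and W :: "'v \<times> 'v \<Rightarrow> ereal"
    and \<Pi> :: "('v \<times> 'v) set"
    and L :: "nat \<Rightarrow> 'v interval_array"
    and N :: nat
  assumes "bipartite_graph G"
    and "weight_matrix G W"
    and "\<forall>e \<in> \<Pi>. W e \<noteq> - \<infinity>"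
    and "\<Pi> \<in> BAP G W"
    and "asa_execution G W \<Pi> L N"
    and "asa_unique G W \<Pi> L N"
  shows "is_lexmax G (L0 G \<inter> LA G W \<Pi>) (L N)"
proof -
  have \<Pi>: "\<Pi> \<in> assignments G" using assms(4) by (simp add: BAP_def is_arg_min_def)
  note setting = assms(1,3) \<Pi>
  have init: "bound (L 0) p = \<infinity>" for p
    using assms(5) by (cases p) (auto simp: asa_execution_def asa_init_def)
  have L0: "L 0 \<in> L0 G" by (simp add: mem_L0_iff init)
  \<comment> \<open>Filling with 0 collapses every interval to 0, so optimality of
    \<open>\<Pi>\<close> for \<open>W\<close> starts the induction.\<close>
  have "capped (L 0) 0 \<in> LA G W \<Pi>"
  proof -
    have zero: "in_array G P (capped (L 0) 0) \<Longrightarrow> e \<in> edges G \<Longrightarrow> P e = 0" for P e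
      using init[of "Inl e"] init[of "Inr e"] by (auto simp: in_array_def fill_def intro: antisym)
    have "bottleneck (\<lambda>e. W e + P e) A = bottleneck W A"
      if "in_array G P (capped (L 0) 0)" "A \<in> assignments G" for P A
      unfolding bottleneck_def using that
      by (intro arg_cong[of _ _ Max] image_cong) (simp_all add: zero assignment_edges[OF setting])
    then show ?thesis
      using assms(4) by (auto simp: LA_def mem_BAP_iff[OF setting])
  qed
  \<comment> \<open>Nothing is determined initially, so the agreement condition is vacuous and every
    array in the intersection is compared.\<close>
  then have result: "L N \<in> L0 G" "\<forall>\<Lambda>' \<in> L0 G \<inter> LA G W \<Pi>. lex_geq G (L N) \<Lambda>'"
    using asa_execution_lexmax[OF setting assms(5,6) le0 L0 order_refl] by (simp_all add: init)
  have "L N \<in> LA G W \<Pi>"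
    using asa_stops_LA[OF setting] assms(5) result(1) by (simp add: asa_execution_def)
  then show ?thesis
    using result by (simp add: is_lexmax_def)
qed

end
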